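(* Let $J_i:\mathbb{Z}_{\ge0}\to\mathbb{R}^{n\times n}$, $i=0,\ldots,N$, be bounded and consider the system $$X(k+1)=\sum_{i=0}^NJ_i(k)X(k)J_i(k)^T,\quad k\ge k_0,\qquad X(k_0)=X_0\in\mathbb{S}^n_{\succeq0}.\qquad(\ast)$$ Let $\mathcal{D}_k^*(P)=\sum_{i=0}^NJ_i(k)^TPJ_i(k)$ for $P\in\mathbb{S}^n$. The following statements are equivalent: (a) The system $(\ast)$ is (globally) uniformly exponentially stable. (b) There exist functions $P,Q:\mathbb{Z}_{\ge0}\to\mathbb{S}^n_{\succ0}$ and constants $\alpha_1,\alpha_2,\beta_1,\beta_2>0$ such that $\alpha_1I\preceq P(k)\preceq\alpha_2I$, $\beta_1I\preceq Q(k)\preceq\beta_2I$ and $$\mathcal{D}_k^*(P(k+1))-P(k)+Q(k)=0$$ hold for all $k\ge0$. (c) There exist a function $P:\mathbb{Z}_{\ge0}\to\mathbb{S}^n_{\succ0}$ and constants $\alpha_1,\alpha_2,\alpha_3>0$ such that $\alpha_1I\preceq P(k)\preceq\alpha_2I$ and $$\mathcal{D}_k^*(P(k+1))-P(k)\preceq-\alpha_3I$$ hold for all $k\ge0$.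
   Context: $\mathbb{S}^n$, $\mathbb{S}^n_{\succeq0}$, $\mathbb{S}^n_{\succ0}$ denote the real symmetric, positive semidefinite and positive definite $n\times n$ matrices; $\preceq$ is the Loewner order. The system is globally uniformly exponentially stable if there exist $\beta\ge1$ and $\rho\in(0,1)$ such that $\|X(k)\|\le\beta\rho^{k-k_0}\|X_0\|$ for all $k\ge k_0$, all $k_0\in\mathbb{Z}_{\ge0}$ and all $X_0\in\mathbb{S}^n_{\succeq0}$ (any matrix norm). *)

theory Defs
  imports "HOL-Analysis.Analysis"
begin

definition sym_mats :: "(real ^ 'n ^ 'n) set" where
  "sym_mats = {A. transpose A = A}"

definition psd_mats :: "(real ^ 'n ^ 'n) set" where
  "psd_mats = {A \<in> sym_mats. \<forall>x. 0 \<le> x \<bullet> (A *v x)}"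

definition pd_mats :: "(real ^ 'n ^ 'n) set" where
  "pd_mats = {A \<in> sym_mats. \<forall>x. x \<noteq> 0 \<longrightarrow> 0 < x \<bullet> (A *v x)}"

definition loewner_le :: "real ^ 'n ^ 'n \<Rightarrow> real ^ 'n ^ 'n \<Rightarrow> bool"  (infix "\<preceq>\<^sub>L" 50) where
  "A \<preceq>\<^sub>L B \<longleftrightarrow> A \<in> sym_mats \<and> B \<in> sym_mats \<and> B - A \<in> psd_mats"

text \<open>
  A norm on the real vector space of matrices. Submultiplicativity is not required, so operator
  norms, entrywise norms and the Frobenius norm (the type-class norm on this type) are all covered.
\<close>

definition is_matrix_norm :: "(real ^ 'n ^ 'n \<Rightarrow> real) \<Rightarrow> bool" where
  "is_matrix_norm \<nu> \<longleftrightarrow>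
     (\<forall>A. 0 \<le> \<nu> A) \<and>
     (\<forall>A. \<nu> A = 0 \<longleftrightarrow> A = 0) \<and>
     (\<forall>c A. \<nu> (c *\<^sub>R A) = \<bar>c\<bar> * \<nu> A) \<and>
     (\<forall>A B. \<nu> (A + B) \<le> \<nu> A + \<nu> B)"

text \<open>
  Here and below \<open>J i k\<close> is the matrix $J_i(k)$, relevant for \<open>i \<le> N\<close> only.
  The values of a trajectory before the initial time \<open>k\<^sub>0\<close> are unconstrained.
\<close>

definition is_trajectory ::
  "nat \<Rightarrow> (nat \<Rightarrow> nat \<Rightarrow> real ^ 'n ^ 'n) \<Rightarrow> nat \<Rightarrow> real ^ 'n ^ 'n \<Rightarrow> (nat \<Rightarrow> real ^ 'n ^ 'n) \<Rightarrow> bool" where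
  "is_trajectory N J k\<^sub>0 X\<^sub>0 X \<longleftrightarrow>
     X k\<^sub>0 = X\<^sub>0 \<and>
     (\<forall>k\<ge>k\<^sub>0. X (k + 1) = (\<Sum>i=0..N. J i k ** X k ** transpose (J i k)))"

definition unif_exp_stable ::
  "(real ^ 'n ^ 'n \<Rightarrow> real) \<Rightarrow> nat \<Rightarrow> (nat \<Rightarrow> nat \<Rightarrow> real ^ 'n ^ 'n) \<Rightarrow> bool" where
  "unif_exp_stable \<nu> N J \<longleftrightarrow>
     (\<exists>\<beta>\<ge>1. \<exists>\<rho>\<in>{0<..<1}. \<forall>k\<^sub>0. \<forall>X\<^sub>0\<in>psd_mats. \<forall>X.
        is_trajectory N J k\<^sub>0 X\<^sub>0 X \<longrightarrow> (\<forall>k\<ge>k\<^sub>0. \<nu> (X k) \<le> \<beta> * \<rho> ^ (k - k\<^sub>0) * \<nu> X\<^sub>0))"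

definition adjoint_op ::
  "nat \<Rightarrow> (nat \<Rightarrow> nat \<Rightarrow> real ^ 'n ^ 'n) \<Rightarrow> nat \<Rightarrow> real ^ 'n ^ 'n \<Rightarrow> real ^ 'n ^ 'n" where
  "adjoint_op N J k P = (\<Sum>i=0..N. transpose (J i k) ** P ** J i k)"

end

theory Submission
  imports Defs
begin

text \<open>
  With the Frobenius inner product, \<open>P \<mapsto> adjoint_op N J k P\<close> is the adjoint of the one-step map of
  the system. Positive semidefinite matrices are sums of rank-one matrices \<open>x x\<^sup>T\<close>, so their pairwise
  inner products are nonnegative and their norm is bounded by their trace. Given (c),
  \<open>V k = P k \<bullet> X k\<close> contracts geometrically along trajectories and is comparable to the norm, which
  gives (a). Given (a), let \<open>T k m\<close> be the result of applying the adjoint one-step maps of the times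
  \<open>k + m - 1, \<dots>, k\<close> to the identity. Then \<open>x \<bullet> (T k m *v x)\<close> is the trace, at time \<open>k + m\<close>, of the
  trajectory that starts at time \<open>k\<close> in \<open>x x\<^sup>T\<close>. It decays geometrically, so \<open>P k = (\<Sum>m. T k m)\<close>
  converges and satisfies \<open>adjoint_op N J k (P (k + 1)) - P k = - I\<close>. Finally (b) and (c) differ
  only by the choice \<open>Q k = P k - adjoint_op N J k (P (k + 1))\<close>.
\<close>

subsection \<open>Frobenius inner product and positive semidefinite matrices\<close>

text \<open>Both sides are the triple sum of \<open>B$i$k * A$i$j * C$k$j\<close>; only the order of
  summation differs. Together with its companion for right factors it moves matrices across the
  inner product.\<close>

lemma inner_matrix_mult_left:
  fixes A B C :: "real ^ 'n ^ 'n"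
  shows "A \<bullet> (B ** C) = (transpose B ** A) \<bullet> C"
proof -
  have "A \<bullet> (B ** C) = (\<Sum>i\<in>UNIV. \<Sum>j\<in>UNIV. \<Sum>k\<in>UNIV. B$i$k * A$i$j * C$k$j)"
    by (simp add: inner_vec_def matrix_matrix_mult_def sum_distrib_left mult_ac)
  also have "\<dots> = (\<Sum>i\<in>UNIV. \<Sum>k\<in>UNIV. \<Sum>j\<in>UNIV. B$i$k * A$i$j * C$k$j)"
    by (intro sum.cong refl sum.swap)
  also have "\<dots> = (\<Sum>k\<in>UNIV. \<Sum>i\<in>UNIV. \<Sum>j\<in>UNIV. B$i$k * A$i$j * C$k$j)"
    by (rule sum.swap)
  also have "\<dots> = (\<Sum>k\<in>UNIV. \<Sum>j\<in>UNIV. \<Sum>i\<in>UNIV. B$i$k * A$i$j * C$k$j)"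
    by (intro sum.cong refl sum.swap)
  also have "\<dots> = (transpose B ** A) \<bullet> C"
    by (simp add: inner_vec_def matrix_matrix_mult_def transpose_def sum_distrib_right)
  finally show ?thesis .
qed

lemma inner_transpose: "transpose A \<bullet> transpose B = A \<bullet> (B :: real ^ 'n ^ 'n)"
  unfolding inner_vec_def transpose_def by (simp, rule sum.swap)

lemma inner_matrix_mult_right:
  fixes A B C :: "real ^ 'n ^ 'n"
  shows "A \<bullet> (B ** C) = (A ** transpose C) \<bullet> B"
proof -
  have "A \<bullet> (B ** C) = transpose A \<bullet> (transpose C ** transpose B)"
    by (metis inner_transpose matrix_transpose_mul)
  also have "\<dots> = (C ** transpose A) \<bullet> transpose B"
    by (simp add: inner_matrix_mult_left)
  also have "\<dots> = transpose (C ** transpose A) \<bullet> B"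
    by (metis inner_transpose transpose_transpose)
  finally show ?thesis
    by (simp add: matrix_transpose_mul)
qed

text \<open>The outer product x x^T.\<close>

definition rank_one :: "real ^ 'n \<Rightarrow> real ^ 'n ^ 'n" where
  "rank_one x = (\<chi> i j. x $ i * x $ j)"

text \<open>Writing a quadratic form as an inner product lets adjointness and passage to limits be
  applied to it.\<close>

lemma inner_rank_one: "A \<bullet> rank_one x = x \<bullet> (A *v x)"
  by (simp add: rank_one_def inner_vec_def matrix_vector_mult_def sum_distrib_left mult_ac)

lemma rank_one_mult_vec: "rank_one v *v x = (v \<bullet> x) *\<^sub>R v"
  by (simp add: rank_one_def vec_eq_iff matrix_vector_mult_def inner_vec_def sum_distrib_left mult_ac)

lemma rank_one_psd: "rank_one x \<in> psd_mats"
  by (simp add: psd_mats_def sym_mats_def rank_one_mult_vec inner_commute)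
    (simp add: rank_one_def transpose_def vec_eq_iff mult.commute)

lemma norm_rank_one: "norm (rank_one x) = (norm x)\<^sup>2"
proof -
  have "rank_one x \<bullet> rank_one x = ((norm x)\<^sup>2)\<^sup>2"
    by (simp add: inner_rank_one rank_one_mult_vec power2_norm_eq_inner)
      (simp add: power2_eq_square)
  then show ?thesis
    by (intro power2_eq_imp_eq[of "norm (rank_one x)"]) (simp_all add: power2_norm_eq_inner)
qed

section \<open>Closure properties of the positive semidefinite cone\<close>

lemma psd_matsD:
  assumes "A \<in> psd_mats"
  shows "transpose A = A" and "0 \<le> x \<bullet> (A *v x)"
  using assms by (auto simp: psd_mats_def sym_mats_def)

lemma psd_matsI: "transpose A = A \<Longrightarrow> (\<And>x. 0 \<le> x \<bullet> (A *v x)) \<Longrightarrow> A \<in> psd_mats"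
  by (auto simp: psd_mats_def sym_mats_def)

lemma transpose_add: "transpose (A + B) = transpose A + transpose (B :: real ^ 'n ^ 'm)"
  by (simp add: transpose_def vec_eq_iff)

lemma transpose_diff: "transpose (A - B) = transpose A - transpose (B :: real ^ 'n ^ 'm)"
  by (simp add: transpose_def vec_eq_iff)

lemma transpose_zero: "transpose 0 = (0 :: real ^ 'n ^ 'm)"
  by (simp add: transpose_def vec_eq_iff)

lemma transpose_uminus: "transpose (- A) = - transpose (A :: real ^ 'n ^ 'm)"
  by (simp add: transpose_def vec_eq_iff)

lemma psd_add: "A \<in> psd_mats \<Longrightarrow> B \<in> psd_mats \<Longrightarrow> A + B \<in> psd_mats"
  by (intro psd_matsI)
    (auto simp: transpose_add psd_matsD matrix_vector_mult_add_rdistrib inner_add_right)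

lemma psd_zero: "0 \<in> psd_mats"
  by (intro psd_matsI) (auto simp: transpose_zero)

lemma psd_sum: "(\<And>i. i \<in> I \<Longrightarrow> f i \<in> psd_mats) \<Longrightarrow> (\<Sum>i\<in>I. f i) \<in> psd_mats"
  by (induction I rule: infinite_finite_induct) (auto intro: psd_add psd_zero)

lemma psd_mat_1: "mat 1 \<in> psd_mats"
  by (intro psd_matsI) (auto simp: transpose_mat)

text \<open>The form of the product at \<open>x\<close> is the form of \<open>A\<close> at
  \<open>B *v x\<close>.\<close>

lemma psd_congruence:
  assumes "A \<in> psd_mats"
  shows "transpose B ** A ** B \<in> psd_mats"
proof (rule psd_matsI)
  show "transpose (transpose B ** A ** B) = transpose B ** A ** B"
    by (simp add: matrix_transpose_mul psd_matsD[OF assms] matrix_mul_assoc)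
  have "x \<bullet> ((transpose B ** A ** B) *v x) = x \<bullet> (transpose B *v (A *v (B *v x)))" for x
    by (simp only: matrix_vector_mul_assoc matrix_mul_assoc)
  also have "\<dots> x = (B *v x) \<bullet> (A *v (B *v x))" for x
    by (simp only: dot_lmul_matrix[symmetric] vector_transpose_matrix)
  finally show "0 \<le> x \<bullet> ((transpose B ** A ** B) *v x)" for x
    using psd_matsD(2)[OF assms, of "B *v x"] by simp
qed

section \<open>Decomposition into outer products\<close>

lemma inner_axis_mult_axis: "axis i 1 \<bullet> (A *v axis j 1) = (A :: real ^ 'n ^ 'n) $ i $ j"
  by (simp add: matrix_vector_mult_basis column_def inner_axis')

lemma psd_diag_nonneg: "A \<in> psd_mats \<Longrightarrow> 0 \<le> A $ i $ i"
  using psd_matsD(2)[of A "axis i 1"] by (simp add: inner_axis_mult_axis)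

lemma sym_inner_commute:
  assumes "transpose A = (A :: real ^ 'n ^ 'n)"
  shows "x \<bullet> (A *v y) = y \<bullet> (A *v x)"
  by (metis assms dot_lmul_matrix inner_commute transpose_matrix_vector)

lemma psd_diag_zero_imp_zero:
  assumes A: "A \<in> psd_mats" and "\<And>i. A $ i $ i = 0"
  shows "A = 0"
proof -
  have "A $ i $ j = 0" for i j
  proof -
    \<comment> \<open>The diagonal terms vanish, so this form is linear in \<open>t\<close>;
      nonnegativity at \<open>t = 1\<close> and \<open>t = -1\<close> forces the entry to be
      zero.\<close>
    have eq: "(axis i 1 + t *\<^sub>R axis j 1) \<bullet> (A *v (axis i 1 + t *\<^sub>R axis j 1)) = 2 * t * A $ i $ j" for t
      using sym_inner_commute[OF psd_matsD(1)[OF A], of "axis j 1" "axis i 1"]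
      by (simp add: matrix_vector_right_distrib matrix_vector_mult_scaleR inner_add_left
          inner_add_right inner_axis_mult_axis assms(2))
    show ?thesis
      using psd_matsD(2)[OF A, of "axis i 1 + 1 *\<^sub>R axis j 1"]
        psd_matsD(2)[OF A, of "axis i 1 + (-1) *\<^sub>R axis j 1"]
      unfolding eq by simp
  qed
  then show ?thesis
    by (simp add: vec_eq_iff)
qed

text \<open>One elimination step of the Cholesky decomposition.\<close>

lemma psd_eliminate:
  fixes A :: "real ^ 'n ^ 'n"
  assumes A: "A \<in> psd_mats" and pos: "0 < A $ j $ j"
  defines "B \<equiv> A - rank_one ((1 / sqrt (A $ j $ j)) *\<^sub>R column j A)"
  shows "B \<in> psd_mats" and "B $ j $ j = 0" and "A $ i $ i = 0 \<Longrightarrow> B $ i $ i = 0"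
proof -
  define c where "c = A $ j $ j"
  have c: "c > 0" using pos by (simp add: c_def)
  have B_entry: "B $ i $ i = A $ i $ i - (A $ i $ j)\<^sup>2 / c" for i
    using c by (simp add: B_def c_def[symmetric] rank_one_def column_def power2_eq_square)
  show B: "B \<in> psd_mats"
  proof (rule psd_matsI)
    show "transpose B = B"
      by (simp add: B_def transpose_diff psd_matsD(1)[OF A] psd_matsD(1)[OF rank_one_psd])
    fix x :: "real ^ 'n"
    define s where "s = column j A \<bullet> x"
    have s: "axis j 1 \<bullet> (A *v x) = s" "x \<bullet> (A *v axis j 1) = s"
      using sym_inner_commute[OF psd_matsD(1)[OF A], of "axis j 1" x]
      by (auto simp: s_def matrix_vector_mult_basis inner_commute)
    \<comment> \<open>Completing the square: the shift by \<open>s / c\<close> minimises the form of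
      \<open>A\<close> along the j-th axis, and the minimum is the form of \<open>B\<close> at
      \<open>x\<close>.\<close>
    have "0 \<le> (x - (s / c) *\<^sub>R axis j 1) \<bullet> (A *v (x - (s / c) *\<^sub>R axis j 1))"
      by (rule psd_matsD[OF A])
    also have "\<dots> = x \<bullet> (A *v x) - s\<^sup>2 / c"
      using c by (simp add: matrix_vector_mult_diff_distrib matrix_vector_mult_scaleR inner_diff_left
          inner_diff_right s inner_axis_mult_axis flip: c_def)
        (simp add: field_simps power2_eq_square)
    also have "\<dots> = x \<bullet> (B *v x)"
      using c by (simp add: B_def c_def[symmetric] matrix_vector_mult_diff_rdistrib inner_diff_right
          rank_one_mult_vec s_def power2_eq_square inner_commute)
    finally show "0 \<le> x \<bullet> (B *v x)" .
  qed
  show "B $ j $ j = 0"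
    using c by (simp add: B_entry c_def[symmetric] power2_eq_square)
  \<comment> \<open>The entry formula gives a nonpositive value here, while positive
    semidefiniteness of \<open>B\<close> gives a nonnegative one.\<close>
  show "B $ i $ i = 0" if "A $ i $ i = 0"
    using psd_diag_nonneg[OF B, of i] that c by (simp add: B_entry divide_le_0_iff)
qed

text \<open>Elimination clears a nonzero diagonal entry and preserves the zero ones, so the number
  of nonzero diagonal entries is a decreasing measure; once it is zero, the matrix itself
  vanishes.\<close>

lemma psd_induct [consumes 1, case_names zero add]:
  assumes "A \<in> psd_mats"
    and zero: "P 0"
    and add: "\<And>A x. A \<in> psd_mats \<Longrightarrow> P A \<Longrightarrow> P (A + rank_one x)"
  shows "P A"
  using assms(1)
proof (induction "card {j. A $ j $ j \<noteq> 0}" arbitrary: A rule: less_induct)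
  case less
  show ?case
  proof (cases "\<forall>j. A $ j $ j = 0")
    case True
    then show ?thesis
      using psd_diag_zero_imp_zero[OF less.prems] zero by simp
  next
    case False
    then obtain j where j: "A $ j $ j \<noteq> 0" by blast
    then have pos: "0 < A $ j $ j"
      using psd_diag_nonneg[OF less.prems, of j] by linarith
    define v where "v = (1 / sqrt (A $ j $ j)) *\<^sub>R column j A"
    note elim = psd_eliminate[OF less.prems pos, folded v_def]
    have "{i. (A - rank_one v) $ i $ i \<noteq> 0} \<subset> {i. A $ i $ i \<noteq> 0}"
      using elim(2,3) j by blast
    then have "P (A - rank_one v)"
      using less.hyps elim(1) by (meson finite psubset_card_mono)
    then show ?thesis
      using add[OF elim(1), of v] by simp
  qed
qed

text \<open>By linearity it suffices to take an outer product for \<open>B\<close>, where the inner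
  product is a value of the quadratic form of \<open>A\<close>.\<close>

lemma psd_inner_nonneg:
  assumes "A \<in> psd_mats" and "B \<in> psd_mats"
  shows "0 \<le> A \<bullet> B"
  using assms(2)
  by (induction rule: psd_induct) (auto simp: inner_add_right inner_rank_one psd_matsD[OF assms(1)])

text \<open>For x x^T both norm and trace equal the squared norm of x; adding such terms keeps the
  bound, as the norm is subadditive and the trace additive.\<close>

lemma psd_norm_le_trace: "A \<in> psd_mats \<Longrightarrow> norm A \<le> mat 1 \<bullet> A"
proof (induction rule: psd_induct)
  case (add A x)
  have "norm (A + rank_one x) \<le> norm A + norm (rank_one x)"
    by (rule norm_triangle_ineq)
  with add show ?case
    by (simp add: inner_add_right inner_rank_one norm_rank_one power2_norm_eq_inner)
qed simp

section \<open>Loewner order and definiteness\<close>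

lemma loewner_le_inner_mono: "A \<preceq>\<^sub>L B \<Longrightarrow> X \<in> psd_mats \<Longrightarrow> A \<bullet> X \<le> B \<bullet> X"
  using psd_inner_nonneg[of "B - A" X] by (simp add: loewner_le_def inner_diff_left)

lemma loewner_leI:
  assumes "transpose A = A" and "transpose B = B" and "\<And>x. x \<bullet> (A *v x) \<le> x \<bullet> (B *v x)"
  shows "A \<preceq>\<^sub>L B"
  using assms
  by (auto simp: loewner_le_def sym_mats_def transpose_diff matrix_vector_mult_diff_rdistrib
      inner_diff_right intro!: psd_matsI)

lemma loewner_le_uminus_iff: "- A \<preceq>\<^sub>L - B \<longleftrightarrow> B \<preceq>\<^sub>L A"
  by (auto simp: loewner_le_def sym_mats_def transpose_uminus)

lemma loewner_leD:
  assumes "A \<preceq>\<^sub>L B"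
  shows "transpose A = A" and "transpose B = B" and "x \<bullet> (A *v x) \<le> x \<bullet> (B *v x)"
  using assms psd_matsD(2)[of "B - A" x]
  by (auto simp: loewner_le_def sym_mats_def matrix_vector_mult_diff_rdistrib inner_diff_right)

lemma pd_psd:
  assumes "A \<in> pd_mats"
  shows "A \<in> psd_mats"
proof (rule psd_matsI)
  show "0 \<le> x \<bullet> (A *v x)" for x
    using assms by (cases "x = 0") (auto simp: pd_mats_def intro: less_imp_le)
qed (use assms in \<open>simp add: pd_mats_def sym_mats_def\<close>)

lemma pd_if_loewner_ge:
  assumes "c *\<^sub>R mat 1 \<preceq>\<^sub>L A" and "c > 0"
  shows "A \<in> pd_mats"
proof -
  have "0 < x \<bullet> (A *v x)" if "x \<noteq> 0" for x
  proof -
    have "0 < c * (x \<bullet> x)" using assms(2) that by simp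
    also have "\<dots> \<le> x \<bullet> (A *v x)"
      using loewner_leD(3)[OF assms(1), of x] by (simp add: flip: scaleR_matrix_vector_assoc)
    finally show ?thesis .
  qed
  then show ?thesis
    using loewner_leD(2)[OF assms(1)] by (auto simp: pd_mats_def sym_mats_def)
qed

subsection \<open>Equivalence of norms\<close>

text \<open>The upper bound comes from expansion in the standard basis, the lower one from the
  minimum of \<open>\<nu>\<close> on the compact Frobenius unit sphere.\<close>

lemma matrix_norm_equiv:
  fixes \<nu> :: "real ^ 'n ^ 'n \<Rightarrow> real"
  assumes "is_matrix_norm \<nu>"
  obtains C D where "C > 0" "D > 0" "\<And>A. \<nu> A \<le> C * norm A" "\<And>A. norm A \<le> D * \<nu> A"
proof -
  have nonneg: "0 \<le> \<nu> A" and zero: "\<nu> A = 0 \<longleftrightarrow> A = 0"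
    and scale: "\<nu> (c *\<^sub>R A) = \<bar>c\<bar> * \<nu> A" and tri: "\<nu> (A + B) \<le> \<nu> A + \<nu> B" for A B c
    using assms by (auto simp: is_matrix_norm_def)
  have sum_le: "\<nu> (\<Sum>i\<in>I. f i) \<le> (\<Sum>i\<in>I. \<nu> (f i))" if "finite I" for f and I :: "(real ^ 'n ^ 'n) set"
    using that
  proof (induction I)
    case empty
    then show ?case using zero[of 0] by simp
  next
    case (insert x F)
    then show ?case using tri[of "f x" "sum f F"] by simp
  qed
  define C where "C = (\<Sum>b\<in>(Basis :: (real ^ 'n ^ 'n) set). \<nu> b) + 1"
  have "0 \<le> (\<Sum>b\<in>(Basis :: (real ^ 'n ^ 'n) set). \<nu> b)"
    by (intro sum_nonneg nonneg)
  then have C: "C > 0" by (simp add: C_def)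
  have upper: "\<nu> A \<le> C * norm A" for A
  proof -
    have "\<nu> A = \<nu> (\<Sum>b\<in>Basis. (A \<bullet> b) *\<^sub>R b)"
      by (simp add: euclidean_representation)
    also have "\<dots> \<le> (\<Sum>b\<in>Basis. \<nu> ((A \<bullet> b) *\<^sub>R b))"
      by (rule sum_le) simp
    also have "\<dots> \<le> (\<Sum>b\<in>Basis. norm A * \<nu> b)"
      unfolding scale by (intro sum_mono mult_right_mono Basis_le_norm nonneg)
    also have "\<dots> \<le> C * norm A"
      by (simp add: C_def sum_distrib_left[symmetric] algebra_simps)
    finally show ?thesis .
  qed
  \<comment> \<open>The reverse triangle inequality and the upper bound make \<open>\<nu>\<close>
    Lipschitz, hence continuous, so the minimum on the sphere is attained.\<close>
  have lip: "dist (\<nu> A) (\<nu> B) \<le> C * dist A B" for A B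
  proof -
    have "\<nu> A \<le> \<nu> B + \<nu> (A - B)" using tri[of B "A - B"] by simp
    moreover have "\<nu> B \<le> \<nu> A + \<nu> (B - A)" using tri[of A "B - A"] by simp
    ultimately show ?thesis
      using upper[of "A - B"] upper[of "B - A"] by (simp add: dist_norm norm_minus_commute)
  qed
  have cont: "continuous_on (sphere 0 1) \<nu>"
    by (rule lipschitz_on_continuous_on[of C]) (use lip C in \<open>auto simp: lipschitz_on_def\<close>)
  have ne: "sphere 0 1 \<noteq> ({} :: (real ^ 'n ^ 'n) set)" by simp
  obtain S where S: "S \<in> sphere 0 1" "\<And>A. A \<in> sphere 0 1 \<Longrightarrow> \<nu> S \<le> \<nu> A"
    using continuous_attains_inf[OF compact_sphere ne cont] by blast
  have "S \<noteq> 0" using S(1) by auto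
  then have \<nu>S: "\<nu> S > 0" using nonneg[of S] zero[of S] by linarith
  have lower: "norm A \<le> (1 / \<nu> S) * \<nu> A" for A
  proof (cases "A = 0")
    case False
    then have "\<nu> S \<le> \<nu> ((1 / norm A) *\<^sub>R A)"
      by (intro S(2)) simp
    with False \<nu>S show ?thesis
      unfolding scale by (simp add: field_simps)
  qed (simp add: zero[THEN iffD2])
  show thesis
    using that[OF C _ upper lower] \<nu>S by simp
qed

subsection \<open>The one-step map and its adjoint\<close>

definition step_op :: "nat \<Rightarrow> (nat \<Rightarrow> nat \<Rightarrow> real ^ 'n ^ 'n) \<Rightarrow> nat \<Rightarrow> real ^ 'n ^ 'n \<Rightarrow> real ^ 'n ^ 'n" where
  "step_op N J k X = (\<Sum>i=0..N. J i k ** X ** transpose (J i k))"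

text \<open>Termwise, the factors \<open>J i k\<close> on either side of \<open>X\<close> are moved
  across the inner product.\<close>

lemma inner_step_op: "P \<bullet> step_op N J k X = adjoint_op N J k P \<bullet> X"
proof -
  have "P \<bullet> (J i k ** X ** transpose (J i k)) = (transpose (J i k) ** P ** J i k) \<bullet> X" for i
    by (simp add: inner_matrix_mult_right[of P "J i k ** X"] inner_matrix_mult_left[of _ "J i k" X]
        matrix_mul_assoc)
  then show ?thesis
    by (simp add: step_op_def adjoint_op_def inner_sum_left inner_sum_right)
qed

lemma psd_adjoint_op: "P \<in> psd_mats \<Longrightarrow> adjoint_op N J k P \<in> psd_mats"
  unfolding adjoint_op_def by (intro psd_sum psd_congruence)

lemma psd_step_op: "X \<in> psd_mats \<Longrightarrow> step_op N J k X \<in> psd_mats"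
  unfolding step_op_def
  using psd_congruence[of X "transpose (J i k)" for i] by (intro psd_sum) simp

text \<open>Pairing with an arbitrary matrix moves the operator off its argument, and the inner
  product is linear in that argument.\<close>

lemma linear_adjoint_op: "linear (adjoint_op N J k)"
  by (rule linearI)
    (simp_all add: vector_eq_rdot[symmetric] inner_add_left flip: inner_step_op)

section \<open>Trajectories and iterated adjoints\<close>

lemma is_trajectory_alt:
  "is_trajectory N J k\<^sub>0 X\<^sub>0 X \<longleftrightarrow> X k\<^sub>0 = X\<^sub>0 \<and> (\<forall>m. X (Suc (k\<^sub>0 + m)) = step_op N J (k\<^sub>0 + m) (X (k\<^sub>0 + m)))"
  by (auto simp: is_trajectory_def step_op_def nat_le_iff_add)

lemma trajectory_psd:
  assumes "is_trajectory N J k\<^sub>0 X\<^sub>0 X" and "X\<^sub>0 \<in> psd_mats"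
  shows "X (k\<^sub>0 + m) \<in> psd_mats"
  using assms by (induction m) (auto simp: is_trajectory_alt psd_step_op)

lemma trajectory_exists:
  obtains X where "is_trajectory N J k\<^sub>0 X\<^sub>0 X"
proof
  \<comment> \<open>Truncated subtraction gives the value \<open>X\<^sub>0\<close> at every time
    before \<open>k\<^sub>0\<close>, which the definition permits.\<close>
  show "is_trajectory N J k\<^sub>0 X\<^sub>0 (\<lambda>k. rec_nat X\<^sub>0 (\<lambda>m. step_op N J (k\<^sub>0 + m)) (k - k\<^sub>0))"
    by (simp add: is_trajectory_alt Suc_diff_le)
qed

text \<open>Lets an induction over the number of steps drop the first one while keeping the same
  \<open>X\<close>.\<close>

lemma trajectory_shift:
  "is_trajectory N J k X\<^sub>0 X \<Longrightarrow> is_trajectory N J (Suc k) (step_op N J k X\<^sub>0) X"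
  by (auto simp: is_trajectory_def step_op_def)

text \<open>The adjoint of the earliest step is applied last, since adjoints compose in reverse
  order; hence \<open>k\<close> advances in the recursive call.\<close>

primrec adjoint_iter :: "nat \<Rightarrow> (nat \<Rightarrow> nat \<Rightarrow> real ^ 'n ^ 'n) \<Rightarrow> nat \<Rightarrow> nat \<Rightarrow> real ^ 'n ^ 'n" where
  "adjoint_iter N J k 0 = mat 1"
| "adjoint_iter N J k (Suc m) = adjoint_op N J k (adjoint_iter N J (Suc k) m)"

text \<open>The outermost adjoint moves onto \<open>X\<^sub>0\<close> as one step of the system, and
  the induction hypothesis applies to the trajectory restarted at \<open>Suc k\<close>.\<close>

lemma inner_adjoint_iter:
  "is_trajectory N J k X\<^sub>0 X \<Longrightarrow> adjoint_iter N J k m \<bullet> X\<^sub>0 = mat 1 \<bullet> X (k + m)"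
proof (induction m arbitrary: k X\<^sub>0)
  case 0
  then show ?case by (simp add: is_trajectory_alt)
next
  case (Suc m)
  from Suc.IH[OF trajectory_shift[OF Suc.prems]] show ?case
    by (simp add: inner_step_op)
qed

lemma psd_adjoint_iter: "adjoint_iter N J k m \<in> psd_mats"
  by (induction m arbitrary: k) (auto simp: psd_mat_1 psd_adjoint_op)

subsection \<open>Lyapunov inequality and stability\<close>

definition lyapunov_bounds :: "(nat \<Rightarrow> real ^ 'n ^ 'n) \<Rightarrow> real \<Rightarrow> real \<Rightarrow> bool" where
  "lyapunov_bounds P \<alpha>\<^sub>1 \<alpha>\<^sub>2 \<longleftrightarrow>
     \<alpha>\<^sub>1 > 0 \<and> \<alpha>\<^sub>2 > 0 \<and> (\<forall>k. \<alpha>\<^sub>1 *\<^sub>R mat 1 \<preceq>\<^sub>L P k \<and> P k \<preceq>\<^sub>L \<alpha>\<^sub>2 *\<^sub>R mat 1)"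

lemma unif_exp_stable_if_lyapunov:
  fixes P :: "nat \<Rightarrow> real ^ 'n ^ 'n"
  assumes \<nu>: "is_matrix_norm \<nu>" and P: "lyapunov_bounds P \<alpha>\<^sub>1 \<alpha>\<^sub>2" and \<alpha>\<^sub>3: "\<alpha>\<^sub>3 > 0"
    and decr: "\<And>k. adjoint_op N J k (P (k + 1)) - P k \<preceq>\<^sub>L - (\<alpha>\<^sub>3 *\<^sub>R mat 1)"
  shows "unif_exp_stable \<nu> N J"
proof -
  obtain C D where CD: "C > 0" "D > 0" and C: "\<And>A. \<nu> A \<le> C * norm A"
    and D: "\<And>A. norm A \<le> D * \<nu> A"
    using matrix_norm_equiv[OF \<nu>] by blast
  have \<nu>_nonneg: "0 \<le> \<nu> A" for A
    using \<nu> by (simp add: is_matrix_norm_def)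
  have \<alpha>: "\<alpha>\<^sub>1 > 0" "\<alpha>\<^sub>2 > 0"
    and lo: "\<And>k. \<alpha>\<^sub>1 *\<^sub>R mat 1 \<preceq>\<^sub>L P k" and up: "\<And>k. P k \<preceq>\<^sub>L \<alpha>\<^sub>2 *\<^sub>R mat 1"
    using P by (auto simp: lyapunov_bounds_def)
  \<comment> \<open>The maximum with 1/2 gives a positive rate without comparing
    \<open>\<alpha>\<^sub>3\<close> and \<open>\<alpha>\<^sub>2\<close>.\<close>
  define \<rho> where "\<rho> = max (1/2) (1 - \<alpha>\<^sub>3 / \<alpha>\<^sub>2)"
  define E where "E = norm (mat 1 :: real ^ 'n ^ 'n)"
  \<comment> \<open>\<open>D\<close>, \<open>E\<close> and \<open>\<alpha>\<^sub>2\<close> bound the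
    initial Lyapunov value by \<open>\<nu> X\<^sub>0\<close>; \<open>\<alpha>\<^sub>1\<close> and
    \<open>C\<close> lead back from the final value to \<open>\<nu>\<close>.\<close>
  define \<beta> where "\<beta> = max 1 (C / \<alpha>\<^sub>1 * (\<alpha>\<^sub>2 * (E * D)))"
  have \<rho>: "\<rho> \<in> {0<..<1}"
    using \<alpha> \<alpha>\<^sub>3 by (auto simp: \<rho>_def)
  have "\<nu> (X (k\<^sub>0 + m)) \<le> \<beta> * \<rho> ^ m * \<nu> X\<^sub>0"
    if X\<^sub>0: "X\<^sub>0 \<in> psd_mats" and X: "is_trajectory N J k\<^sub>0 X\<^sub>0 X" for k\<^sub>0 X\<^sub>0 X m
  proof -
    note psd = trajectory_psd[OF X X\<^sub>0]
    have V: "P (k\<^sub>0 + m) \<bullet> X (k\<^sub>0 + m) \<le> \<rho> ^ m * (P k\<^sub>0 \<bullet> X\<^sub>0)" for m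
    proof (induction m)
      case 0
      then show ?case using X by (simp add: is_trajectory_alt)
    next
      case (Suc m)
      let ?k = "k\<^sub>0 + m"
      have up': "P ?k \<bullet> X ?k \<le> \<alpha>\<^sub>2 * (mat 1 \<bullet> X ?k)"
        using loewner_le_inner_mono[OF up psd] by simp
      have nn: "0 \<le> P ?k \<bullet> X ?k"
        using pd_if_loewner_ge[OF lo \<alpha>(1)] pd_psd psd psd_inner_nonneg by blast
      have "P (Suc ?k) \<bullet> X (Suc ?k) = adjoint_op N J ?k (P (?k + 1)) \<bullet> X ?k"
        using X by (simp add: is_trajectory_alt inner_step_op)
      also have "\<dots> \<le> P ?k \<bullet> X ?k - \<alpha>\<^sub>3 * (mat 1 \<bullet> X ?k)"
        using loewner_le_inner_mono[OF decr[of ?k] psd[of m]] by (simp add: inner_diff_left)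
      \<comment> \<open>The trace of \<open>X ?k\<close> is at least
        \<open>(P ?k \<bullet> X ?k) / \<alpha>\<^sub>2\<close>, so a decrease by a multiple of the
        trace becomes a relative decrease.\<close>
      also have "\<dots> \<le> P ?k \<bullet> X ?k - \<alpha>\<^sub>3 * ((P ?k \<bullet> X ?k) / \<alpha>\<^sub>2)"
        using up' \<alpha> \<alpha>\<^sub>3 by (intro diff_left_mono mult_left_mono) (auto simp: field_simps)
      also have "\<dots> = (1 - \<alpha>\<^sub>3 / \<alpha>\<^sub>2) * (P ?k \<bullet> X ?k)"
        by (simp add: algebra_simps)
      also have "\<dots> \<le> \<rho> * (P ?k \<bullet> X ?k)"
        by (intro mult_right_mono nn) (simp add: \<rho>_def)
      also have "\<dots> \<le> \<rho> * (\<rho> ^ m * (P k\<^sub>0 \<bullet> X\<^sub>0))"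
        using Suc \<rho> by (intro mult_left_mono) auto
      finally show ?case by (simp add: mult.assoc)
    qed
    have "P k\<^sub>0 \<bullet> X\<^sub>0 \<le> \<alpha>\<^sub>2 * (mat 1 \<bullet> X\<^sub>0)"
      using loewner_le_inner_mono[OF up X\<^sub>0] by simp
    also have "\<dots> \<le> \<alpha>\<^sub>2 * (E * (D * \<nu> X\<^sub>0))"
    proof -
      have "mat 1 \<bullet> X\<^sub>0 \<le> E * norm X\<^sub>0"
        unfolding E_def by (rule norm_cauchy_schwarz)
      also have "\<dots> \<le> E * (D * \<nu> X\<^sub>0)"
        by (intro mult_left_mono D) (simp add: E_def)
      finally show ?thesis using \<alpha> by simp
    qed
    finally have V0: "P k\<^sub>0 \<bullet> X\<^sub>0 \<le> \<alpha>\<^sub>2 * (E * (D * \<nu> X\<^sub>0))" .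
    let ?X = "X (k\<^sub>0 + m)"
    \<comment> \<open>Pass from \<open>\<nu>\<close> to the Frobenius norm, then to the trace, then
      by the lower bound on \<open>P\<close> to the Lyapunov value, where the contraction
      applies.\<close>
    have "\<nu> ?X \<le> C * norm ?X"
      by (rule C)
    also have "\<dots> \<le> C * (mat 1 \<bullet> ?X)"
      using CD by (intro mult_left_mono psd_norm_le_trace psd) auto
    also have "\<dots> \<le> C * ((P (k\<^sub>0 + m) \<bullet> ?X) / \<alpha>\<^sub>1)"
      using loewner_le_inner_mono[OF lo[of "k\<^sub>0 + m"] psd[of m]] CD \<alpha>
      by (intro mult_left_mono) (auto simp: field_simps)
    also have "\<dots> \<le> C * ((\<rho> ^ m * (\<alpha>\<^sub>2 * (E * (D * \<nu> X\<^sub>0)))) / \<alpha>\<^sub>1)"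
    proof -
      have "P (k\<^sub>0 + m) \<bullet> ?X \<le> \<rho> ^ m * (\<alpha>\<^sub>2 * (E * (D * \<nu> X\<^sub>0)))"
        using \<rho> by (intro order_trans[OF V] mult_left_mono V0) auto
      then show ?thesis
        using CD \<alpha> by (intro mult_left_mono divide_right_mono) auto
    qed
    also have "\<dots> = (C / \<alpha>\<^sub>1 * (\<alpha>\<^sub>2 * (E * D))) * (\<rho> ^ m * \<nu> X\<^sub>0)"
      by simp
    also have "\<dots> \<le> \<beta> * (\<rho> ^ m * \<nu> X\<^sub>0)"
      using \<rho> \<nu>_nonneg by (intro mult_right_mono) (auto simp: \<beta>_def)
    finally show ?thesis by (simp add: mult.assoc)
  qed
  then have "\<forall>k\<^sub>0. \<forall>X\<^sub>0\<in>psd_mats. \<forall>X. is_trajectory N J k\<^sub>0 X\<^sub>0 X \<longrightarrow>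
      (\<forall>k\<ge>k\<^sub>0. \<nu> (X k) \<le> \<beta> * \<rho> ^ (k - k\<^sub>0) * \<nu> X\<^sub>0)"
    by (metis le_add_diff_inverse)
  moreover have "\<beta> \<ge> 1" by (simp add: \<beta>_def)
  ultimately show ?thesis
    unfolding unif_exp_stable_def using \<rho> by blast
qed

lemma lyapunov_if_unif_exp_stable:
  fixes J :: "nat \<Rightarrow> nat \<Rightarrow> real ^ 'n ^ 'n"
  assumes \<nu>: "is_matrix_norm \<nu>" and stable: "unif_exp_stable \<nu> N J"
  obtains P \<alpha> where "lyapunov_bounds P 1 \<alpha>"
    and "\<And>k. adjoint_op N J k (P (k + 1)) - P k = - mat 1"
proof -
  obtain C D where CD: "C > 0" "D > 0" and C: "\<And>A. \<nu> A \<le> C * norm A"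
    and D: "\<And>A. norm A \<le> D * \<nu> A"
    using matrix_norm_equiv[OF \<nu>] by blast
  obtain \<beta> \<rho> where \<beta>: "\<beta> \<ge> 1" and \<rho>: "\<rho> \<in> {0<..<1}"
    and st: "\<And>k\<^sub>0 X\<^sub>0 X k. X\<^sub>0 \<in> psd_mats \<Longrightarrow> is_trajectory N J k\<^sub>0 X\<^sub>0 X \<Longrightarrow> k \<ge> k\<^sub>0 \<Longrightarrow>
      \<nu> (X k) \<le> \<beta> * \<rho> ^ (k - k\<^sub>0) * \<nu> X\<^sub>0"
    using stable unfolding unif_exp_stable_def by blast
  define T where "T = adjoint_iter N J"
  define K where "K = norm (mat 1 :: real ^ 'n ^ 'n) * D * \<beta> * C"
  have K: "K \<ge> 0" using CD \<beta> by (simp add: K_def)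
  have T_sym: "transpose (T k m) = T k m" and T_nonneg: "0 \<le> x \<bullet> (T k m *v x)" for k m x
    using psd_matsD[OF psd_adjoint_iter] by (auto simp: T_def)
  \<comment> \<open>The starting matrix x x^T has a norm quadratic in x, so stability bounds the
    form uniformly in \<open>k\<close> with geometric decay in \<open>m\<close>.\<close>
  have T_quad: "x \<bullet> (T k m *v x) \<le> K * \<rho> ^ m * (x \<bullet> x)" for k m x
  proof -
    obtain X where X: "is_trajectory N J k (rank_one x) X"
      by (rule trajectory_exists)
    have "x \<bullet> (T k m *v x) = mat 1 \<bullet> X (k + m)"
      unfolding T_def inner_rank_one[symmetric] by (rule inner_adjoint_iter[OF X])
    also have "\<dots> \<le> norm (mat 1 :: real ^ 'n ^ 'n) * norm (X (k + m))"
      by (rule norm_cauchy_schwarz)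
    also have "\<dots> \<le> norm (mat 1 :: real ^ 'n ^ 'n) * (D * (\<beta> * \<rho> ^ m * (C * norm (rank_one x))))"
    proof (intro mult_left_mono)
      have "norm (X (k + m)) \<le> D * \<nu> (X (k + m))" by (rule D)
      also have "\<dots> \<le> D * (\<beta> * \<rho> ^ m * \<nu> (rank_one x))"
        using st[OF rank_one_psd X, of "k + m"] CD by simp
      also have "\<dots> \<le> D * (\<beta> * \<rho> ^ m * (C * norm (rank_one x)))"
        using CD \<beta> \<rho> by (intro mult_left_mono C) auto
      finally show "norm (X (k + m)) \<le> D * (\<beta> * \<rho> ^ m * (C * norm (rank_one x)))" .
    qed simp
    also have "\<dots> = K * \<rho> ^ m * (x \<bullet> x)"
      by (simp add: K_def norm_rank_one power2_norm_eq_inner mult_ac)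
    finally show ?thesis .
  qed
  have summ: "summable (T k)" for k
  proof (rule summable_comparison_test)
    \<comment> \<open>The trace sums the quadratic form over the unit axis vectors, each term being
      at most \<open>K * \<rho> ^ m\<close>; hence the factor \<open>CARD('n)\<close>.\<close>
    have "norm (T k m) \<le> real CARD('n) * K * \<rho> ^ m" for m
    proof -
      have "norm (T k m) \<le> mat 1 \<bullet> T k m"
        unfolding T_def by (intro psd_norm_le_trace psd_adjoint_iter)
      also have "\<dots> = (\<Sum>i\<in>UNIV. axis i 1 \<bullet> (T k m *v axis i 1))"
        unfolding inner_axis_mult_axis
        by (simp add: inner_vec_def[of "mat 1"] mat_def inner_vec_def if_distrib[of "\<lambda>a. a * _"] cong: if_cong)
      also have "\<dots> \<le> (\<Sum>i\<in>(UNIV :: 'n set). K * \<rho> ^ m)"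
        by (intro sum_mono order_trans[OF T_quad]) (simp add: inner_axis_axis)
      finally show ?thesis by simp
    qed
    then show "\<exists>M. \<forall>m\<ge>M. norm (T k m) \<le> real CARD('n) * K * \<rho> ^ m" by blast
    show "summable (\<lambda>m. real CARD('n) * K * \<rho> ^ m)"
      using \<rho> by (intro summable_mult summable_geometric) auto
  qed
  define P where "P k = (\<Sum>m. T k m)" for k
  \<comment> \<open>\<open>K / (1 - \<rho>)\<close> is the sum of the geometric majorant; adding 1
    makes positivity follow from \<open>K \<ge> 0\<close>.\<close>
  define \<alpha> where "\<alpha> = K / (1 - \<rho>) + 1"
  have \<alpha>: "\<alpha> > 0" using K \<rho> by (auto simp: \<alpha>_def intro!: add_nonneg_pos)
  \<comment> \<open>Pairing with x x^T is bounded linear, so it commutes with the series.\<close>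
  have P_quad: "(\<lambda>m. x \<bullet> (T k m *v x)) sums (x \<bullet> (P k *v x))" for k x
    unfolding inner_rank_one[symmetric] P_def
    by (rule bounded_linear.sums[OF bounded_linear_inner_left summable_sums[OF summ]])
  have lin_t: "linear (transpose :: real ^ 'n ^ 'n \<Rightarrow> _)"
    by (rule linearI) (auto simp: transpose_add transpose_scalar)
  have "transpose (P k) = P k" for k
    unfolding P_def
    using bounded_linear.suminf[OF linear_conv_bounded_linear[THEN iffD1, OF lin_t] summ[of k]]
    by (simp add: T_sym)
  \<comment> \<open>Only the term at index 0, the identity, is kept; the others are
    nonnegative.\<close>
  moreover have "x \<bullet> x \<le> x \<bullet> (P k *v x)" for k x
    using sum_le_suminf[OF sums_summable[OF P_quad], of "{0}" x k] T_nonneg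
    by (simp add: sums_unique[OF P_quad, symmetric]) (simp add: T_def)
  moreover have "x \<bullet> (P k *v x) \<le> \<alpha> * (x \<bullet> x)" for k x
  proof -
    have "(\<lambda>m. K * \<rho> ^ m * (x \<bullet> x)) sums (K * (1 / (1 - \<rho>)) * (x \<bullet> x))"
      using \<rho> by (intro sums_mult sums_mult2 geometric_sums) auto
    then have "x \<bullet> (P k *v x) \<le> K * (1 / (1 - \<rho>)) * (x \<bullet> x)"
      by (rule sums_le[OF T_quad P_quad])
    also have "\<dots> \<le> \<alpha> * (x \<bullet> x)"
      by (intro mult_right_mono) (auto simp: \<alpha>_def)
    finally show ?thesis .
  qed
  ultimately have "lyapunov_bounds P 1 \<alpha>"
    using \<alpha> by (auto simp: lyapunov_bounds_def transpose_scalar intro!: loewner_leI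
        simp flip: scaleR_matrix_vector_assoc)
  moreover have "adjoint_op N J k (P (k + 1)) - P k = - mat 1" for k
  proof -
    \<comment> \<open>A linear map in finite dimension is bounded and acts termwise. It turns
      \<open>T (Suc k) m\<close> into \<open>T k (Suc m)\<close>, so only the head
      \<open>T k 0 = mat 1\<close> of the series for \<open>P k\<close> is missing.\<close>
    have "adjoint_op N J k (P (k + 1)) = (\<Sum>m. adjoint_op N J k (T (Suc k) m))"
      unfolding P_def
      using bounded_linear.suminf[OF linear_conv_bounded_linear[THEN iffD1, OF linear_adjoint_op] summ]
      by simp
    also have "\<dots> = (\<Sum>m. T k (Suc m))"
      by (simp add: T_def)
    also have "\<dots> = P k - mat 1"
      unfolding P_def using suminf_split_head[OF summ[of k]] by (simp add: T_def)
    finally show ?thesis by simp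
  qed
  ultimately show thesis by (rule that)
qed


section \<open>Equivalence of stability with the two Lyapunov conditions\<close>

theorem theorem4p3:
  fixes J :: "nat \<Rightarrow> nat \<Rightarrow> real ^ 'n ^ 'n"
    and N :: nat
    and \<nu> :: "real ^ 'n ^ 'n \<Rightarrow> real"
  assumes J_bounded: "\<And>i. i \<le> N \<Longrightarrow> bounded (range (J i))"
    and norm_\<nu>: "is_matrix_norm \<nu>"
  defines "a \<equiv> unif_exp_stable \<nu> N J"
    and "b \<equiv> (\<exists>(P :: nat \<Rightarrow> real ^ 'n ^ 'n) (Q :: nat \<Rightarrow> real ^ 'n ^ 'n) \<alpha>\<^sub>1 \<alpha>\<^sub>2 \<beta>\<^sub>1 \<beta>\<^sub>2.
           (\<forall>k. P k \<in> pd_mats) \<and> (\<forall>k. Q k \<in> pd_mats) \<and>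
           \<alpha>\<^sub>1 > 0 \<and> \<alpha>\<^sub>2 > 0 \<and> \<beta>\<^sub>1 > 0 \<and> \<beta>\<^sub>2 > 0 \<and>
           (\<forall>k. \<alpha>\<^sub>1 *\<^sub>R mat 1 \<preceq>\<^sub>L P k \<and> P k \<preceq>\<^sub>L \<alpha>\<^sub>2 *\<^sub>R mat 1 \<and>
                \<beta>\<^sub>1 *\<^sub>R mat 1 \<preceq>\<^sub>L Q k \<and> Q k \<preceq>\<^sub>L \<beta>\<^sub>2 *\<^sub>R mat 1 \<and>
                adjoint_op N J k (P (k + 1)) - P k + Q k = 0))"
    and "c \<equiv> (\<exists>(P :: nat \<Rightarrow> real ^ 'n ^ 'n) \<alpha>\<^sub>1 \<alpha>\<^sub>2 \<alpha>\<^sub>3.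
           (\<forall>k. P k \<in> pd_mats) \<and> \<alpha>\<^sub>1 > 0 \<and> \<alpha>\<^sub>2 > 0 \<and> \<alpha>\<^sub>3 > 0 \<and>
           (\<forall>k. \<alpha>\<^sub>1 *\<^sub>R mat 1 \<preceq>\<^sub>L P k \<and> P k \<preceq>\<^sub>L \<alpha>\<^sub>2 *\<^sub>R mat 1 \<and>
                adjoint_op N J k (P (k + 1)) - P k \<preceq>\<^sub>L - (\<alpha>\<^sub>3 *\<^sub>R mat 1)))"
  shows "(a \<longleftrightarrow> b) \<and> (b \<longleftrightarrow> c)"
proof -
  have "b \<Longrightarrow> c"
  proof -
    assume b
    then obtain P Q \<alpha>\<^sub>1 \<alpha>\<^sub>2 \<beta>\<^sub>1 \<beta>\<^sub>2 where PQ: "\<forall>k. P k \<in> pd_mats" "\<alpha>\<^sub>1 > 0" "\<alpha>\<^sub>2 > 0" "\<beta>\<^sub>1 > 0"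
      and k: "\<And>k. \<alpha>\<^sub>1 *\<^sub>R mat 1 \<preceq>\<^sub>L P k \<and> P k \<preceq>\<^sub>L \<alpha>\<^sub>2 *\<^sub>R mat 1 \<and> \<beta>\<^sub>1 *\<^sub>R mat 1 \<preceq>\<^sub>L Q k \<and>
        adjoint_op N J k (P (k + 1)) - P k + Q k = 0"
      unfolding b_def by blast
    \<comment> \<open>The lower bound on \<open>Q\<close> serves as
      \<open>\<alpha>\<^sub>3\<close>.\<close>
    have "adjoint_op N J k (P (k + 1)) - P k \<preceq>\<^sub>L - (\<beta>\<^sub>1 *\<^sub>R mat 1)" for k
    proof -
      have "adjoint_op N J k (P (k + 1)) - P k = - Q k"
        using k[of k] by (simp add: eq_neg_iff_add_eq_0)
      then show ?thesis
        using k[of k] by (simp add: loewner_le_uminus_iff)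
    qed
    with PQ k show c
      unfolding c_def by blast
  qed
  moreover have "c \<Longrightarrow> b"
  proof -
    assume c
    then obtain P \<alpha>\<^sub>1 \<alpha>\<^sub>2 \<alpha>\<^sub>3 where P: "\<forall>k. P k \<in> pd_mats" "\<alpha>\<^sub>1 > 0" "\<alpha>\<^sub>2 > 0" "\<alpha>\<^sub>3 > 0"
      and k: "\<And>k. \<alpha>\<^sub>1 *\<^sub>R mat 1 \<preceq>\<^sub>L P k \<and> P k \<preceq>\<^sub>L \<alpha>\<^sub>2 *\<^sub>R mat 1 \<and>
        adjoint_op N J k (P (k + 1)) - P k \<preceq>\<^sub>L - (\<alpha>\<^sub>3 *\<^sub>R mat 1)"
      unfolding c_def by blast
    define Q where "Q k = P k - adjoint_op N J k (P (k + 1))" for k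
    have lo: "\<alpha>\<^sub>3 *\<^sub>R mat 1 \<preceq>\<^sub>L Q k" for k
      using k[of k] loewner_le_uminus_iff[of "Q k" "\<alpha>\<^sub>3 *\<^sub>R mat 1"] by (simp add: Q_def)
    \<comment> \<open>\<open>Q k\<close> arises from \<open>P k\<close> by subtracting a positive
      semidefinite matrix, so it inherits the upper bound.\<close>
    have "Q k \<preceq>\<^sub>L \<alpha>\<^sub>2 *\<^sub>R mat 1" for k
    proof (rule loewner_leI)
      show "x \<bullet> (Q k *v x) \<le> x \<bullet> ((\<alpha>\<^sub>2 *\<^sub>R mat 1) *v x)" for x
      proof -
        have "0 \<le> x \<bullet> (adjoint_op N J k (P (k + 1)) *v x)"
          using P(1) by (intro psd_matsD(2) psd_adjoint_op pd_psd) blast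
        moreover have "x \<bullet> (P k *v x) \<le> x \<bullet> ((\<alpha>\<^sub>2 *\<^sub>R mat 1) *v x)"
          using k by (intro loewner_leD(3)) blast
        ultimately show ?thesis
          by (simp add: Q_def matrix_vector_mult_diff_rdistrib inner_diff_right)
      qed
    qed (use loewner_leD(2)[OF lo] in \<open>auto simp: transpose_scalar\<close>)
    moreover have "Q k \<in> pd_mats" for k
      using pd_if_loewner_ge[OF lo P(4)] .
    moreover have "adjoint_op N J k (P (k + 1)) - P k + Q k = 0" for k
      by (simp add: Q_def)
    \<comment> \<open>The bounds for \<open>Q\<close> are
      \<open>\<beta>\<^sub>1 = \<alpha>\<^sub>3\<close> and
      \<open>\<beta>\<^sub>2 = \<alpha>\<^sub>2\<close>.\<close>
    ultimately show b
      unfolding b_def using P k lo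
      by - (rule exI[of _ P], rule exI[of _ Q], rule exI[of _ \<alpha>\<^sub>1], rule exI[of _ \<alpha>\<^sub>2],
          rule exI[of _ \<alpha>\<^sub>3], rule exI[of _ \<alpha>\<^sub>2], intro conjI allI; simp)
  qed
  moreover have "c \<Longrightarrow> a"
  proof -
    assume c
    then obtain P \<alpha>\<^sub>1 \<alpha>\<^sub>2 \<alpha>\<^sub>3 where "lyapunov_bounds P \<alpha>\<^sub>1 \<alpha>\<^sub>2" "\<alpha>\<^sub>3 > 0"
      "\<And>k. adjoint_op N J k (P (k + 1)) - P k \<preceq>\<^sub>L - (\<alpha>\<^sub>3 *\<^sub>R mat 1)"
      unfolding c_def lyapunov_bounds_def by blast
    then show a
      unfolding a_def by (rule unif_exp_stable_if_lyapunov[OF norm_\<nu>])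
  qed
  moreover have "a \<Longrightarrow> c"
  proof -
    assume a
    then obtain P \<alpha> where P: "lyapunov_bounds P 1 \<alpha>"
      and eq: "\<And>k. adjoint_op N J k (P (k + 1)) - P k = - mat 1"
      unfolding a_def using lyapunov_if_unif_exp_stable[OF norm_\<nu>] by blast
    \<comment> \<open>The difference equals \<open>- mat 1\<close>, so 1 serves as
      \<open>\<alpha>\<^sub>3\<close>.\<close>
    have "adjoint_op N J k (P (k + 1)) - P k \<preceq>\<^sub>L - (1 *\<^sub>R mat 1)" for k
      using transpose_scalar[of "-1" "mat 1 :: real ^ 'n ^ 'n"]
      unfolding eq by (intro loewner_leI) auto
    moreover have "P k \<in> pd_mats" for k
      using P pd_if_loewner_ge[of 1 "P k"] by (simp add: lyapunov_bounds_def)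
    ultimately show c
      unfolding c_def using P
      by - (rule exI[of _ P], rule exI[of _ 1], rule exI[of _ \<alpha>], rule exI[of _ 1],
          auto simp: lyapunov_bounds_def)
  qed
  ultimately show ?thesis by blast
qed

end
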